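(* Let $k\in\{1,2,3\}$ and let $G$ be a $k$-degenerated graph without any isolated edge. Then $$\chi_{1-vsdt}(G)\le k\Delta(G)+3,$$ where $\Delta(G)$ is the maximum degree of $G$.
   Context: All graphs are finite, simple and undirected. A graph $G$ is $k$-degenerated if $\delta(H)\le k$ for every subgraph $H$ of $G$, where $\delta(H)$ is the minimum degree. For a vertex $u$ of $G$, let $N\langle u\rangle = N[u]\cup\{uv : v\in N(u)\}$, where $N(u)$ and $N[u]=N(u)\cup\{u\}$ are the open and closed neighborhoods; so $N\langle u\rangle$ consists of $u$, its neighbors and its incident edges. A proper $\kappa$-total coloring of $G$ is a map $f:V(G)\cup E(G)\to\{1,\dots,\kappa\}$ such that any two adjacent vertices, any two edges sharing an endpoint, and any vertex and incident edge receive different colors. Put $C_f\langle u\rangle=\{f(x): x\in N\langle u\rangle\}$. For a graph $G$ with no isolated edges (no connected component is $K_2$), a $\kappa$-$D(1)$-VSDTC of $G$ ($1$-vertex-strongly-distinguishing total coloring) is a proper $\kappa$-total coloring $f$ such that $C_f\langle u\rangle\neq C_f\langle v\rangle$ for any two adjacent vertices $u,v$. $\chi_{1-vsdt}(G)$ is the minimum $\kappa$ for which $G$ admits a $\kappa$-$D(1)$-VSDTC. *)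

theory Defs
  imports Main "HOL-Library.Extended_Nat"
begin

text \<open>
  A graph is given by its vertex set \<open>V\<close> and its edge set \<open>E\<close>, where the edge \<open>uv\<close> is the
  two-element set \<open>{u, v}\<close>. The graph without vertices is allowed.
\<close>

definition simple_graph :: "'a set \<Rightarrow> 'a set set \<Rightarrow> bool" where
  "simple_graph V E \<longleftrightarrow> finite V \<and> (\<forall>e\<in>E. e \<subseteq> V \<and> card e = 2)"

definition subgraph :: "'a set \<Rightarrow> 'a set set \<Rightarrow> 'a set \<Rightarrow> 'a set set \<Rightarrow> bool" where
  "subgraph W F V E \<longleftrightarrow> simple_graph W F \<and> W \<subseteq> V \<and> F \<subseteq> E"

definition neighbors :: "'a set set \<Rightarrow> 'a \<Rightarrow> 'a set" where
  "neighbors E u = {v. {u, v} \<in> E}"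

definition degree :: "'a set set \<Rightarrow> 'a \<Rightarrow> nat" where
  "degree E u = card (neighbors E u)"

text \<open>Meaningful only for nonempty \<open>V\<close>.\<close>

definition min_degree :: "'a set \<Rightarrow> 'a set set \<Rightarrow> nat" where
  "min_degree V E = Min (degree E ` V)"

text \<open>Inserting \<open>0\<close> only matters for empty \<open>V\<close>, where the maximum degree is taken to be \<open>0\<close>.\<close>

definition max_degree :: "'a set \<Rightarrow> 'a set set \<Rightarrow> nat" where
  "max_degree V E = Max (insert 0 (degree E ` V))"

definition degenerated :: "nat \<Rightarrow> 'a set \<Rightarrow> 'a set set \<Rightarrow> bool" where
  "degenerated k V E \<longleftrightarrow> (\<forall>W F. subgraph W F V E \<and> W \<noteq> {} \<longrightarrow> min_degree W F \<le> k)"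

definition component_verts :: "'a set set \<Rightarrow> 'a \<Rightarrow> 'a set" where
  "component_verts E u = {v. (u, v) \<in> {(x, y). {x, y} \<in> E}\<^sup>*}"

text \<open>Connected components, as pairs of a vertex set and the edge set induced on it.\<close>

definition components :: "'a set \<Rightarrow> 'a set set \<Rightarrow> ('a set \<times> 'a set set) set" where
  "components V E = (\<lambda>u. (component_verts E u, {e \<in> E. e \<subseteq> component_verts E u})) ` V"

definition no_isolated_edge :: "'a set \<Rightarrow> 'a set set \<Rightarrow> bool" where
  "no_isolated_edge V E \<longleftrightarrow>
     \<not> (\<exists>u v. u \<noteq> v \<and> ({u, v}, {{u, v}}) \<in> components V E)"

text \<open>
  Elements of \<open>V(G) \<union> E(G)\<close> are represented in a sum type: \<open>Inl u\<close> is the vertex \<open>u\<close> and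
  \<open>Inr e\<close> is the edge \<open>e\<close>. A coloring is a total function, of which only the values on
  \<open>V <+> E\<close> are relevant.
\<close>

definition proper_total_coloring ::
  "'a set \<Rightarrow> 'a set set \<Rightarrow> nat \<Rightarrow> ('a + 'a set \<Rightarrow> nat) \<Rightarrow> bool" where
  "proper_total_coloring V E \<kappa> f \<longleftrightarrow>
     f ` (V <+> E) \<subseteq> {1..\<kappa>} \<and>
     (\<forall>u\<in>V. \<forall>v\<in>V. {u, v} \<in> E \<longrightarrow> f (Inl u) \<noteq> f (Inl v)) \<and>
     (\<forall>e\<in>E. \<forall>e'\<in>E. e \<noteq> e' \<and> e \<inter> e' \<noteq> {} \<longrightarrow> f (Inr e) \<noteq> f (Inr e')) \<and>
     (\<forall>e\<in>E. \<forall>u\<in>e. f (Inl u) \<noteq> f (Inr e))"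

definition strong_nbhd :: "'a set set \<Rightarrow> 'a \<Rightarrow> ('a + 'a set) set" where
  "strong_nbhd E u = insert u (neighbors E u) <+> {{u, v} |v. v \<in> neighbors E u}"

definition color_set :: "'a set set \<Rightarrow> ('a + 'a set \<Rightarrow> nat) \<Rightarrow> 'a \<Rightarrow> nat set" where
  "color_set E f u = f ` strong_nbhd E u"

definition D1_VSDTC ::
  "'a set \<Rightarrow> 'a set set \<Rightarrow> nat \<Rightarrow> ('a + 'a set \<Rightarrow> nat) \<Rightarrow> bool" where
  "D1_VSDTC V E \<kappa> f \<longleftrightarrow>
     proper_total_coloring V E \<kappa> f \<and>
     (\<forall>u\<in>V. \<forall>v\<in>V. {u, v} \<in> E \<longrightarrow> color_set E f u \<noteq> color_set E f v)"

text \<open>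
  The minimum is taken in \<open>enat\<close>, so that the value is \<open>\<infinity>\<close> if there is no such coloring;
  an upper bound thus includes the existence of a coloring.
\<close>

definition chi_1_vsdt :: "'a set \<Rightarrow> 'a set set \<Rightarrow> enat" where
  "chi_1_vsdt V E = Inf {enat \<kappa> |\<kappa>. \<exists>f. D1_VSDTC V E \<kappa> f}"

end

theory Submission
  imports Defs
begin

text \<open>
  For \<open>k = 2, 3\<close> delete a vertex \<open>v\<close> of degree at most \<open>k\<close>, colour the rest by induction and extend
  greedily: first \<open>v\<close>, then the edges at \<open>v\<close> one after another. If the colour sets of adjacent
  vertices \<open>u, w\<close> differ, then adding a new colour to the set of \<open>u\<close> makes them equal for at most
  one choice of it. So every neighbour of \<open>v\<close> forbids at most \<open>\<Delta>\<close> colours for \<open>v\<close>, and at most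
  \<open>2 \<Delta>\<close> colours are forbidden for a new edge, apart from the colours of earlier new edges. The
  remaining freedom suffices to separate \<open>v\<close> from its neighbours.

  In a forest some vertex \<open>u\<close> has only leaves as neighbours, with at most one exception. Delete the
  leaves at \<open>u\<close> but keep one neighbour \<open>p\<close>. Giving all reinserted leaves the colour of the edge
  \<open>up\<close> leaves enough choice for the set of new edge colours to separate \<open>u\<close> from \<open>p\<close>.
\<close>

section \<open>Neighbourhoods, colour sets and proper total colourings\<close>

lemma ex_color_avoiding:
  assumes "finite X" "card X < \<kappa>"
  shows "\<exists>a\<in>{1..\<kappa>}. a \<notin> X"
proof (rule ccontr)
  assume "\<not> ?thesis"
  then have "card {1..\<kappa>} \<le> card X" by (intro card_mono assms) auto
  then show False using assms by simp
qed

lemma neighbors_iff: "v \<in> neighbors E u \<longleftrightarrow> {u, v} \<in> E"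
  by (simp add: neighbors_def)

lemma neighbors_sym: "v \<in> neighbors E u \<longleftrightarrow> u \<in> neighbors E v"
  by (simp add: neighbors_def insert_commute)

lemma color_set_eq:
  "color_set E f u = insert (f (Inl u))
    ((\<lambda>w. f (Inl w)) ` neighbors E u \<union> (\<lambda>w. f (Inr {u, w})) ` neighbors E u)"
  unfolding color_set_def strong_nbhd_def Plus_def by (auto simp: image_iff)

context
  fixes V :: "'a set" and E :: "'a set set"
  assumes simple: "simple_graph V E"
begin

lemma edgeD:
  assumes "{u, v} \<in> E"
  shows "u \<in> V" "v \<in> V" "u \<noteq> v"
  using simple assms unfolding simple_graph_def by (auto dest!: bspec)

lemma edge_cases:
  assumes "e \<in> E"
  obtains u v where "e = {u, v}" "u \<noteq> v"
  using simple assms unfolding simple_graph_def by (metis card_2_iff)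

lemma finite_neighbors: "finite (neighbors E u)"
proof (rule finite_subset)
  show "neighbors E u \<subseteq> V" using edgeD by (auto simp: neighbors_iff)
  show "finite V" using simple by (simp add: simple_graph_def)
qed

lemma not_self_neighbor: "u \<notin> neighbors E u"
  using edgeD(3)[of u u] by (auto simp: neighbors_iff)

text \<open>Vertices and their neighbours replace abstract edges: two distinct edges meeting in
  \<open>u\<close> are \<open>{u, v}\<close> and \<open>{u, w}\<close>. As adjacency is symmetric,
  the condition on \<open>u\<close> and \<open>{u, v}\<close> covers both ends of an edge.\<close>

lemma proper_total_coloring_iff:
  "proper_total_coloring V E \<kappa> f \<longleftrightarrow>
     (\<forall>u\<in>V. f (Inl u) \<in> {1..\<kappa>}) \<and>
     (\<forall>u v. v \<in> neighbors E u \<longrightarrow> f (Inr {u, v}) \<in> {1..\<kappa>} \<and> f (Inl u) \<noteq> f (Inl v) \<and>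
        f (Inl u) \<noteq> f (Inr {u, v})) \<and>
     (\<forall>u v w. v \<in> neighbors E u \<longrightarrow> w \<in> neighbors E u \<longrightarrow> v \<noteq> w \<longrightarrow>
        f (Inr {u, v}) \<noteq> f (Inr {u, w}))"
  (is "?L \<longleftrightarrow> ?R1 \<and> ?R2 \<and> ?R3")
proof
  assume L: ?L
  then have "f ` (V <+> E) \<subseteq> {1..\<kappa>}" by (simp add: proper_total_coloring_def)
  then have r: "f x \<in> {1..\<kappa>}" if "x \<in> V <+> E" for x
    using that by (rule subsetD[OF _ imageI])
  have ?R1 using r by blast
  moreover have ?R2
  proof (intro allI impI)
    fix u v assume "v \<in> neighbors E u"
    then have e: "{u, v} \<in> E" by (simp add: neighbors_iff)
    then have "f (Inl u) \<noteq> f (Inl v)"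
      using L edgeD[OF e] by (simp add: proper_total_coloring_def)
    moreover have "f (Inl u) \<noteq> f (Inr {u, v})"
      using L e by (simp add: proper_total_coloring_def)
    ultimately show "f (Inr {u, v}) \<in> {1..\<kappa>} \<and> f (Inl u) \<noteq> f (Inl v) \<and>
        f (Inl u) \<noteq> f (Inr {u, v})"
      using r[OF InrI[OF e]] by blast
  qed
  moreover have ?R3
  proof (intro allI impI)
    fix u v w assume *: "v \<in> neighbors E u" "w \<in> neighbors E u" "v \<noteq> w"
    then have "{u, v} \<noteq> {u, w}" by (auto simp: doubleton_eq_iff)
    moreover have "{u, v} \<inter> {u, w} \<noteq> {}" by blast
    ultimately show "f (Inr {u, v}) \<noteq> f (Inr {u, w})"
      using L * by (simp add: proper_total_coloring_def neighbors_iff)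
  qed
  ultimately show "?R1 \<and> ?R2 \<and> ?R3" by blast
next
  assume R: "?R1 \<and> ?R2 \<and> ?R3"
  have "f x \<in> {1..\<kappa>}" if "x \<in> V <+> E" for x
    using that
  proof (rule PlusE)
    fix u assume "u \<in> V" "x = Inl u" then show ?thesis using R by simp
  next
    fix e assume "e \<in> E" "x = Inr e"
    moreover then obtain u v where "e = {u, v}" by (blast elim: edge_cases)
    ultimately show ?thesis using R by (simp add: neighbors_iff)
  qed
  moreover have "f (Inr e) \<noteq> f (Inr e')" if *: "e \<in> E" "e' \<in> E" "e \<noteq> e'" "e \<inter> e' \<noteq> {}" for e e'
  proof -
    obtain u where u: "u \<in> e" "u \<in> e'" using * by blast
    obtain v where v: "e = {u, v}" using *(1) u(1) by (metis edge_cases insertE singletonD insert_commute)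
    obtain w where w: "e' = {u, w}" using *(2) u(2) by (metis edge_cases insertE singletonD insert_commute)
    show ?thesis using R * unfolding v w by (metis neighbors_iff)
  qed
  moreover have "f (Inl u) \<noteq> f (Inr e)" if *: "e \<in> E" "u \<in> e" for e u
  proof -
    obtain v where "e = {u, v}" using * by (metis edge_cases insertE singletonD insert_commute)
    then show ?thesis using R * by (metis neighbors_iff)
  qed
  moreover have "f (Inl u) \<noteq> f (Inl v)" if "{u, v} \<in> E" for u v
    using R that by (simp add: neighbors_iff)
  ultimately show ?L
    unfolding proper_total_coloring_def image_subset_iff by simp
qed

end

section \<open>Colourings that exempt isolated edges\<close>

text \<open>Isolated edges are exempted, since deleting vertices may create them.\<close>

definition good_coloring ::
  "'a set \<Rightarrow> 'a set set \<Rightarrow> nat \<Rightarrow> ('a + 'a set \<Rightarrow> nat) \<Rightarrow> bool" where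
  "good_coloring V E \<kappa> f \<longleftrightarrow>
     proper_total_coloring V E \<kappa> f \<and>
     (\<forall>u v. v \<in> neighbors E u \<longrightarrow> 2 \<le> degree E u \<longrightarrow> color_set E f u \<noteq> color_set E f v)"

text \<open>Otherwise nothing else could be reached from \<open>u\<close>, and the edge would be a
  component.\<close>

lemma no_isolated_edgeD:
  assumes simple: "simple_graph V E" and "no_isolated_edge V E" and uv: "v \<in> neighbors E u"
  shows "2 \<le> degree E u \<or> 2 \<le> degree E v"
proof (rule ccontr)
  assume "\<not> ?thesis"
  then have "card (neighbors E u) \<le> 1" "card (neighbors E v) \<le> 1" by (auto simp: degree_def)
  then have nu: "neighbors E u = {v}" and nv: "neighbors E v = {u}"
    using uv finite_neighbors[OF simple]
    by (metis One_nat_def card_le_Suc0_iff_eq neighbors_sym is_singletonI' is_singleton_def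
        singletonD empty_iff)+
  have e: "{u, v} \<in> E" using uv by (simp add: neighbors_iff)
  note uvD = edgeD[OF simple e]
  have "w \<in> {u, v}" if "(u, w) \<in> {(x, y). {x, y} \<in> E}\<^sup>*" for w
    using that
  proof induction
    case base then show ?case by simp
  next
    case (step y z)
    then have "z \<in> neighbors E y" by (simp add: neighbors_iff)
    then show ?case using step nu nv by auto
  qed
  moreover have "(u, u) \<in> {(x, y). {x, y} \<in> E}\<^sup>*" "(u, v) \<in> {(x, y). {x, y} \<in> E}\<^sup>*"
    using e by auto
  ultimately have cu: "component_verts E u = {u, v}" unfolding component_verts_def by blast
  have "{e \<in> E. e \<subseteq> {u, v}} = {{u, v}}"
  proof -
    have "e' = {u, v}" if "e' \<in> E" "e' \<subseteq> {u, v}" for e'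
      using that by (elim edge_cases[OF simple]) auto
    then show ?thesis using e by blast
  qed
  then have "({u, v}, {{u, v}}) \<in> components V E"
    unfolding components_def using cu uvD(1) by (intro image_eqI[of _ _ u]) auto
  then show False using assms(2) uvD(3) unfolding no_isolated_edge_def by blast
qed

text \<open>Every edge now has an end of degree at least 2, to which the one-sided condition of
  \<open>good_coloring\<close> applies.\<close>

lemma good_coloring_imp_D1_VSDTC:
  assumes "simple_graph V E" "no_isolated_edge V E" "good_coloring V E \<kappa> f"
  shows "D1_VSDTC V E \<kappa> f"
  unfolding D1_VSDTC_def
proof (intro conjI ballI impI)
  show "proper_total_coloring V E \<kappa> f" using assms(3) by (simp add: good_coloring_def)
next
  fix u v assume "{u, v} \<in> E"
  then have uv: "v \<in> neighbors E u" "u \<in> neighbors E v"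
    by (auto simp: neighbors_iff insert_commute)
  show "color_set E f u \<noteq> color_set E f v"
    using no_isolated_edgeD[OF assms(1,2) uv(1)] uv assms(3)
    unfolding good_coloring_def by metis
qed

section \<open>Degeneracy and vertex deletion\<close>

lemma degenerated_vertex:
  assumes "degenerated k V E" "subgraph W F V E" "W \<noteq> {}"
  obtains v where "v \<in> W" "degree F v \<le> k"
proof -
  have "min_degree W F \<le> k" using assms unfolding degenerated_def by blast
  moreover have "finite W" using assms unfolding subgraph_def simple_graph_def by blast
  then have "min_degree W F \<in> degree F ` W"
    unfolding min_degree_def using assms by (intro Min_in) auto
  ultimately show ?thesis using that by auto
qed

lemma degenerated_subgraph:
  assumes "degenerated k V E" "subgraph W F V E"
  shows "degenerated k W F"
proof -
  have "subgraph W' F' V E" if "subgraph W' F' W F" for W' F'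
    using that assms(2) unfolding subgraph_def by blast
  then show ?thesis using assms(1) unfolding degenerated_def by simp
qed

lemma subgraph_delete:
  assumes "simple_graph V E"
  shows "subgraph (V - X) {e \<in> E. e \<inter> X = {}} V E"
  using assms unfolding subgraph_def simple_graph_def by auto

lemma neighbors_delete:
  "neighbors {e \<in> E. e \<inter> X = {}} u = (if u \<in> X then {} else neighbors E u - X)"
  by (auto simp: neighbors_def)

lemma degree_subset_le:
  assumes "simple_graph V E" "F \<subseteq> E"
  shows "degree F u \<le> degree E u"
  unfolding degree_def using assms
  by (intro card_mono finite_neighbors[OF assms(1)]) (auto simp: neighbors_iff)

section \<open>Greedy choice of the colours at a new vertex\<close>

text \<open>
  Here \<open>N\<close> is the set of neighbours of a new vertex, and for \<open>u \<in> N\<close> the old graph has the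
  neighbours \<open>M u\<close>, vertex colour \<open>c u\<close>, incident edge colours \<open>B u\<close> and colour set \<open>C u\<close>.
  The colour \<open>a\<close> of the new vertex is chosen first; \<open>b u\<close> is the colour of the new edge to \<open>u\<close>.
\<close>

locale vertex_extension =
  fixes N :: "'a set" and M :: "'a \<Rightarrow> 'a set" and c :: "'a \<Rightarrow> nat"
    and B C :: "'a \<Rightarrow> nat set" and D \<kappa> :: nat
  assumes finite_N: "finite N"
    and finite_C: "u \<in> N \<Longrightarrow> finite (C u)"
    and M: "u \<in> N \<Longrightarrow> finite (M u)" "u \<in> N \<Longrightarrow> card (M u) < D"
    and B: "u \<in> N \<Longrightarrow> finite (B u)" "u \<in> N \<Longrightarrow> card (B u) < D"
    and irrefl: "u \<in> N \<Longrightarrow> u \<notin> M u"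
    and sym: "u \<in> N \<Longrightarrow> w \<in> N \<Longrightarrow> w \<in> M u \<Longrightarrow> u \<in> M w"
    and distinct: "u \<in> N \<Longrightarrow> w \<in> M u \<Longrightarrow> C u \<noteq> C w \<or> C u \<subseteq> {c u, c w} \<union> B u"
begin

text \<open>Adding \<open>a\<close> on both sides also settles a \<open>w\<close> outside
  \<open>N\<close>, whose set does not receive \<open>a\<close>: \<open>insert a (C u) = C w\<close>
  would put \<open>a\<close> into \<open>C w\<close>.\<close>

definition center_color :: "nat \<Rightarrow> bool" where
  "center_color a \<longleftrightarrow> a \<in> {1..\<kappa>} \<and>
     (\<forall>u\<in>N. a \<noteq> c u \<and> (\<forall>w\<in>M u. C u \<noteq> C w \<longrightarrow> insert a (C u) \<noteq> insert a (C w)))"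

text \<open>The colour set of an old vertex at the stage where exactly the new edges to
  \<open>S\<close> are coloured.\<close>

definition cols :: "nat \<Rightarrow> ('a \<Rightarrow> nat) \<Rightarrow> 'a set \<Rightarrow> 'a \<Rightarrow> nat set" where
  "cols a b S w =
     (if w \<in> S then insert (b w) (insert a (C w)) else if w \<in> N then insert a (C w) else C w)"

text \<open>Invariant of the greedy procedure. An old isolated edge may keep equal colour sets until
  one of its ends enters \<open>S\<close>.\<close>

definition partial :: "nat \<Rightarrow> ('a \<Rightarrow> nat) \<Rightarrow> 'a set \<Rightarrow> bool" where
  "partial a b S \<longleftrightarrow> S \<subseteq> N \<and> inj_on b S \<and>
     (\<forall>u\<in>S. b u \<in> {1..\<kappa>} \<and> b u \<notin> {a, c u} \<union> B u) \<and>
     (\<forall>u\<in>S. \<forall>w\<in>M u. cols a b S u \<noteq> cols a b S w)"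

text \<open>The last condition separates the new vertex from \<open>u\<close>. It is waived exactly
  when their edge is isolated, that is, \<open>N = {u}\<close> and \<open>M u\<close> is
  empty.\<close>

definition complete :: "nat \<Rightarrow> ('a \<Rightarrow> nat) \<Rightarrow> bool" where
  "complete a b \<longleftrightarrow> center_color a \<and> partial a b N \<and>
     (\<forall>u\<in>N. 2 \<le> card N \<or> M u \<noteq> {} \<longrightarrow>
        insert a (c ` N \<union> b ` N) \<noteq> insert (b u) (insert a (C u)))"

lemma partial_empty: "partial a b {}"
  by (simp add: partial_def)

lemma partialD:
  assumes "partial a b S" "u \<in> S"
  shows "b u \<noteq> a" "b u \<noteq> c u" "b u \<in> {1..\<kappa>}" "b u \<notin> B u"
  using assms unfolding partial_def by blast+

lemma partial_neq:
  assumes "partial a b S" "u \<in> S" "w \<in> S" "u \<noteq> w"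
  shows "b u \<noteq> b w"
  using assms unfolding partial_def inj_on_def by blast

text \<open>A common new colour can equate two different sets only if it is their whole symmetric
  difference, so each \<open>w\<close> forbids at most one \<open>a\<close>. As
  \<open>card (M u) < D\<close>, each \<open>u\<close> forbids at most \<open>D\<close> colours,
  \<open>c u\<close> included.\<close>

lemma ex_center_color:
  assumes "finite Z" "card N * D + card Z < \<kappa>"
  shows "\<exists>a. center_color a \<and> a \<notin> Z"
proof -
  define bad where
    "bad u w = {a. C u \<noteq> C w \<and> insert a (C u) = insert a (C w)}" for u w
  have bad: "finite (bad u w)" "card (bad u w) \<le> 1" for u w
  proof -
    have "x = y" if "x \<in> bad u w" "y \<in> bad u w" for x y
      using that unfolding bad_def by (simp add: set_eq_iff) metis
    then have "bad u w = {} \<or> (\<exists>x. bad u w = {x})" by blast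
    then show "finite (bad u w)" "card (bad u w) \<le> 1" by auto
  qed
  define X where "X u = insert (c u) (\<Union>w\<in>M u. bad u w)" for u
  have X: "finite (X u)" "card (X u) \<le> D" if "u \<in> N" for u
  proof -
    show "finite (X u)" unfolding X_def using bad M[OF that] by simp
    have "card (\<Union>w\<in>M u. bad u w) \<le> (\<Sum>w\<in>M u. card (bad u w))"
      using M[OF that] by (intro card_UN_le)
    also have "\<dots> \<le> card (M u)" using sum_bounded_above[of "M u" "\<lambda>w. card (bad u w)" 1] bad by simp
    finally show "card (X u) \<le> D"
      unfolding X_def using M[OF that] card_insert_le_m1[of "D" "\<Union>w\<in>M u. bad u w" "c u"] by simp
  qed
  have "card ((\<Union>u\<in>N. X u) \<union> Z) \<le> card (\<Union>u\<in>N. X u) + card Z" by (rule card_Un_le)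
  also have "card (\<Union>u\<in>N. X u) \<le> (\<Sum>u\<in>N. card (X u))" using finite_N by (rule card_UN_le)
  also have "\<dots> \<le> card N * D" using sum_bounded_above[of N "\<lambda>u. card (X u)" D] X by simp
  finally have "card ((\<Union>u\<in>N. X u) \<union> Z) < \<kappa>" using assms by simp
  moreover have "finite ((\<Union>u\<in>N. X u) \<union> Z)" using assms(1) X finite_N by simp
  ultimately obtain a where "a \<in> {1..\<kappa>}" "a \<notin> (\<Union>u\<in>N. X u) \<union> Z"
    using ex_color_avoiding by blast
  then have "center_color a \<and> a \<notin> Z"
    unfolding center_color_def X_def bad_def by blast
  then show ?thesis by blast
qed

text \<open>The count: \<open>Q\<close> has at most \<open>D + 1\<close> colours, the at most
  \<open>D - 1\<close> vertices of \<open>M u\<close> forbid one further colour each, and the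
  earlier new edges forbid \<open>card S\<close>. What is left may be spent on
  \<open>Z\<close>.\<close>

lemma partial_step:
  assumes a: "center_color a" and b: "partial a b S" and u: "u \<in> N" "u \<notin> S"
    and Z: "finite Z" "2 * D + card S + card Z < \<kappa>"
  shows "\<exists>x. x \<notin> Z \<and> partial a (b(u := x)) (insert u S)"
proof -
  define K where "K = insert a (C u)"
  define Q where "Q = {a, c u} \<union> B u"
  define bad where "bad w = {x. x \<notin> Q \<and> insert x K = cols a b S w}" for w
  have S: "S \<subseteq> N" "finite S" using b finite_N finite_subset unfolding partial_def by auto
  have bad: "finite (bad w)" "card (bad w) \<le> 1" if w: "w \<in> M u" for w
  proof -
    \<comment> \<open>Either alternative leaves at most one bad colour. In the first, a bad colour
      is the only one that \<open>K\<close> lacks; in the second, two distinct bad colours would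
      both lie in \<open>K\<close> outside \<open>Q\<close>, where only \<open>c w\<close> is
      left.\<close>
    have "K \<noteq> cols a b S w \<or> K \<subseteq> insert (c w) Q"
    proof (cases "w \<in> S")
      \<comment> \<open>The invariant already separates \<open>w\<close> from the present set of
        \<open>u\<close>, which is \<open>K\<close>.\<close>
      case True
      then have "u \<in> M w" using sym u S w by blast
      then have "cols a b S w \<noteq> cols a b S u" using b True unfolding partial_def by blast
      then show ?thesis using u by (auto simp: cols_def K_def)
    next
      case False
      show ?thesis
      proof (cases "C u = C w")
        case True
        then show ?thesis using distinct[OF u(1) w] by (auto simp: K_def Q_def)
      next
        case neq: False
        then have "K \<noteq> insert a (C w)" using a u w unfolding center_color_def K_def by blast
        then show ?thesis using False by (auto simp: cols_def K_def)
      qed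
    qed
    then have "x = y" if "x \<in> bad w" "y \<in> bad w" for x y
      using that unfolding bad_def by (simp add: set_eq_iff subset_iff) metis
    then have "bad w = {} \<or> (\<exists>x. bad w = {x})" by blast
    then show "finite (bad w)" "card (bad w) \<le> 1" by auto
  qed
  define X where "X = Q \<union> (\<Union>w\<in>M u. bad w) \<union> b ` S \<union> Z"
  have "card (\<Union>w\<in>M u. bad w) \<le> (\<Sum>w\<in>M u. card (bad w))"
    using M(1)[OF u(1)] by (rule card_UN_le)
  also have "\<dots> \<le> card (M u)" using sum_bounded_above[of "M u" "\<lambda>w. card (bad w)" 1] bad by simp
  finally have 1: "card (\<Union>w\<in>M u. bad w) < D" using M(2)[OF u(1)] by simp
  have "card Q \<le> card {a, c u} + card (B u)" unfolding Q_def by (rule card_Un_le)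
  moreover have "card {a, c u} \<le> 2" by (simp add: card_insert_if)
  ultimately have 2: "card Q \<le> D + 1" using B(2)[OF u(1)] by linarith
  have 3: "card (b ` S) \<le> card S" using S by (simp add: card_image_le)
  have "card X \<le> card Q + card (\<Union>w\<in>M u. bad w) + card (b ` S) + card Z"
    unfolding X_def by (meson card_Un_le add_le_mono1 order_trans)
  then have "card X < \<kappa>" using 1 2 3 Z by linarith
  moreover have "finite X"
    unfolding X_def Q_def using B M u bad S Z by simp
  ultimately obtain x where x: "x \<in> {1..\<kappa>}" "x \<notin> X" using ex_color_avoiding by blast
  let ?b = "b(u := x)" and ?S = "insert u S"
  have same: "cols a ?b ?S w = cols a b S w" if "w \<noteq> u" for w
    using that by (simp add: cols_def)
  have new: "cols a ?b ?S u \<noteq> cols a ?b ?S w" if "w \<in> M u" for w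
  proof -
    have "w \<noteq> u" using that irrefl u by blast
    moreover have "insert x K \<noteq> cols a b S w" using x(2) that unfolding X_def bad_def by blast
    ultimately show ?thesis using same by (simp add: cols_def K_def)
  qed
  have "partial a ?b ?S"
    unfolding partial_def
  proof (intro conjI)
    show "?S \<subseteq> N" using S u by simp
    show "inj_on ?b ?S"
      using b u x(2) unfolding partial_def X_def inj_on_def by auto
    show "\<forall>v\<in>?S. ?b v \<in> {1..\<kappa>} \<and> ?b v \<notin> {a, c v} \<union> B v"
      using b u x unfolding partial_def X_def Q_def by auto
    show "\<forall>v\<in>?S. \<forall>w\<in>M v. cols a ?b ?S v \<noteq> cols a ?b ?S w"
    proof (intro ballI)
      fix v w assume v: "v \<in> ?S" and w: "w \<in> M v"
      consider "v = u" | "v \<in> S" "v \<noteq> u" "w = u" | "v \<in> S" "v \<noteq> u" "w \<noteq> u" using v by blast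
      then show "cols a ?b ?S v \<noteq> cols a ?b ?S w"
      proof cases
        case 1 then show ?thesis using new w by simp
      next
        case 2
        then have "v \<in> M u" using sym[of v u] S u w by blast
        then show ?thesis using new 2 by metis
      next
        case 3
        then show ?thesis using b w same unfolding partial_def by simp
      qed
    qed
  qed
  then show ?thesis using x(2) unfolding X_def by blast
qed

lemma complete_0:
  assumes "N = {}" "0 < \<kappa>"
  shows "\<exists>a b. complete a b"
proof -
  obtain a where "center_color a" using ex_center_color[of "{}"] assms by auto
  then have "complete a b" for b
    using assms(1) partial_empty[of a b] unfolding complete_def by (metis empty_iff)
  then show ?thesis by blast
qed

text \<open>\<open>z\<close> is the colour of an old edge at \<open>u\<close>. The new vertex sees
  only \<open>a\<close>, \<open>c u\<close> and the new edge colour, all different from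
  \<open>z\<close>. If \<open>B u\<close> is empty, so is \<open>M u\<close>, and nothing has to be
  separated.\<close>

lemma complete_1:
  assumes N: "N = {u}" and B0: "M u = {} \<longleftrightarrow> B u = {}" and BC: "B u \<subseteq> C u - {c u}"
    and \<kappa>: "2 * D < \<kappa>"
  shows "\<exists>a b. complete a b"
proof -
  have D: "0 < D" using M(2)[of u] N by simp
  obtain z where z: "B u \<noteq> {} \<longrightarrow> z \<in> B u" by blast
  obtain a where a: "center_color a" "a \<noteq> z"
    using ex_center_color[of "{z}"] N \<kappa> D by auto
  fix b0
  obtain x where x: "partial a (b0(u := x)) {u}"
    using partial_step[OF a(1) partial_empty[of a b0], of u "{}"] N \<kappa> by auto
  have "x \<notin> B u" using x by (simp add: partial_def)
  have "insert a {c u, x} \<noteq> insert x (insert a (C u))" if "M u \<noteq> {}"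
  proof -
    have "z \<in> B u" using that z B0 by blast
    then have "z \<in> C u" "z \<notin> insert a {c u, x}" using \<open>x \<notin> B u\<close> a(2) BC by auto
    then show ?thesis by blast
  qed
  then have "complete a (b0(u := x))" using x a N unfolding complete_def by auto
  then show ?thesis by blast
qed

text \<open>
  The colour \<open>x1\<close> is chosen outside the colour set of \<open>u2\<close>, or so that this set has two colours
  that are missing so far in the set of the new vertex; then \<open>x2\<close> alone cannot make them equal.
\<close>

lemma complete_2:
  assumes N: "N = {u1, u2}" "u1 \<noteq> u2" and \<kappa>: "2 * D + 2 < \<kappa>"
  shows "\<exists>a b. complete a b"
proof -
  obtain a where a: "center_color a" using ex_center_color[of "{}"] N \<kappa> by auto
  let ?T = "C u2 - {a, c u1, c u2}"
  have fin: "finite (C u1)" "finite (C u2)" using finite_C N by auto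
  \<comment> \<open>The bound on \<open>\<kappa>\<close> allows two extra colours to be avoided here
    and one for \<open>x2\<close>, since the edge to \<open>u1\<close> costs one. Avoiding
    \<open>?T\<close> and \<open>c u2\<close> keeps \<open>x1\<close> out of \<open>C u2\<close>, as
    \<open>a\<close> and \<open>c u1\<close> are excluded anyway.\<close>
  obtain Z1 where Z1: "finite Z1" "card Z1 \<le> 2"
    "?T \<union> {c u2} \<subseteq> Z1 \<or> card Z1 = 2 \<and> Z1 \<subseteq> ?T"
  proof (cases "card ?T \<le> 1")
    case True
    then have "card (?T \<union> {c u2}) \<le> 2" using card_Un_le[of ?T "{c u2}"] by simp
    then show ?thesis using that[of "?T \<union> {c u2}"] fin by simp
  next
    case False
    then have "2 \<le> card ?T" by linarith
    then obtain Z where "Z \<subseteq> ?T" "card Z = 2" using obtain_subset_with_card_n by metis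
    then show ?thesis using that[of Z] fin finite_subset[of Z ?T] by simp
  qed
  fix b0
  obtain x1 where x1: "x1 \<notin> Z1" "partial a (b0(u1 := x1)) {u1}"
    using partial_step[OF a partial_empty[of a b0], of u1 Z1] N Z1 \<kappa> by auto
  define Y where "Y = insert x1 (insert a (C u1))"
  \<comment> \<open>So far the new vertex sees \<open>{a, c u1, c u2, x1}\<close>. If
    \<open>Y\<close> has another colour, \<open>x2\<close> must avoid one such colour; otherwise
    avoiding \<open>c u1\<close> keeps \<open>x2\<close> out of \<open>Y\<close>.\<close>
  obtain z where z: "if Y \<subseteq> {a, c u1, c u2, x1} then z = c u1 else z \<in> Y - {a, c u1, c u2, x1}"
    by (cases "Y \<subseteq> {a, c u1, c u2, x1}") auto
  obtain x2 where x2: "x2 \<noteq> z" "partial a (b0(u1 := x1, u2 := x2)) {u2, u1}"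
    using partial_step[OF a x1(2), of u2 "{z}"] N \<kappa> by auto
  let ?b = "b0(u1 := x1, u2 := x2)"
  have p: "partial a ?b N" using x2 N by (simp add: insert_commute)
  have xs: "x1 \<noteq> x2" "x1 \<noteq> a" "x1 \<noteq> c u1" "x2 \<noteq> a" "x2 \<noteq> c u2"
    using partial_neq[OF p, of u1 u2] partialD(1,2)[OF p, of u1] partialD(1,2)[OF p, of u2] N
    by simp_all
  have "{a, c u1, c u2, x1, x2} \<noteq> Y"
  proof (cases "Y \<subseteq> {a, c u1, c u2, x1}")
    case True
    then have "x2 \<notin> Y" using z x2(1) xs by auto
    then show ?thesis by blast
  next
    case False
    then have "z \<in> Y" "z \<notin> {a, c u1, c u2, x1, x2}" using z x2(1) by auto
    then show ?thesis by metis
  qed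
  moreover have "{a, c u1, c u2, x1, x2} \<noteq> insert x2 (insert a (C u2))" (is "?S \<noteq> ?R")
  proof (cases "?T \<union> {c u2} \<subseteq> Z1")
    case True
    then have "x1 \<notin> C u2" using x1(1) xs by blast
    then show ?thesis using xs by blast
  next
    case False
    then have c2: "card Z1 = 2" and sub: "Z1 \<subseteq> ?T" using Z1 by auto
    show ?thesis
    proof
      assume "?S = ?R"
      then have "Z1 \<subseteq> {x2}" using sub x1(1) by blast
      then have "card Z1 \<le> card {x2}" by (intro card_mono) auto
      then show False using c2 by simp
    qed
  qed
  ultimately have "complete a ?b"
    using a p N unfolding complete_def Y_def by (auto simp: insert_commute)
  then show ?thesis by blast
qed

text \<open>
  The colours \<open>x1\<close>, \<open>x2\<close>, \<open>x3\<close> separate the new vertex from \<open>u3\<close>, \<open>u1\<close>, \<open>u2\<close>, in this order. In the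
  first two cases nothing has to be avoided if the other set has too many private colours.
\<close>

lemma complete_3:
  assumes N: "N = {u1, u2, u3}" "u1 \<noteq> u2" "u1 \<noteq> u3" "u2 \<noteq> u3"
    and \<kappa>: "3 * D < \<kappa>" "2 * D + 5 < \<kappa>"
  shows "\<exists>a b. complete a b"
proof -
  have "card N = 3" using N by simp
  then obtain a where a: "center_color a" using ex_center_color[of "{}"] \<kappa> by auto
  have fin: "finite (C u1)" "finite (C u2)" "finite (C u3)" using finite_C N by auto
  let ?T = "C u3 - {a, c u1, c u2, c u3}"
  \<comment> \<open>Each earlier new edge costs one colour, so \<open>2 * D + 5 < \<kappa>\<close>
    admits 5, 4 and 3 colours in \<open>Z1\<close>, \<open>Z2\<close> and \<open>Z3\<close>. More
    than three colours of \<open>?T\<close> cannot all be among \<open>x1\<close>,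
    \<open>x2\<close>, \<open>x3\<close>.\<close>
  obtain Z1 where Z1: "finite Z1" "card Z1 \<le> 5" "?T \<union> {c u2, c u3} \<subseteq> Z1 \<or> 3 < card ?T"
  proof (cases "card ?T \<le> 3")
    case True
    then have "card (?T \<union> {c u2, c u3}) \<le> 5"
      using card_Un_le[of ?T "{c u2, c u3}"] card_insert_le_m1[of 2 "{c u3}" "c u2"] by simp
    then show ?thesis using that[of "?T \<union> {c u2, c u3}"] fin by simp
  next
    case False
    then show ?thesis using that[of "{}"] by simp
  qed
  fix b0
  obtain x1 where x1: "x1 \<notin> Z1" "partial a (b0(u1 := x1)) {u1}"
    using partial_step[OF a partial_empty[of a b0], of u1 Z1] N Z1 \<kappa> by auto
  define Y1 where "Y1 = insert x1 (insert a (C u1))"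
  let ?R = "Y1 - {a, c u1, x1, c u2, c u3}"
  have finY1: "finite Y1" using fin by (simp add: Y1_def)
  \<comment> \<open>Only \<open>x2\<close> and \<open>x3\<close> are still to come at the new
    vertex, so the threshold drops to two.\<close>
  obtain Z2 where Z2: "finite Z2" "card Z2 \<le> 4" "?R \<union> {c u1, c u3} \<subseteq> Z2 \<or> 2 < card ?R"
  proof (cases "card ?R \<le> 2")
    case True
    then have "card (?R \<union> {c u1, c u3}) \<le> 4"
      using card_Un_le[of ?R "{c u1, c u3}"] card_insert_le_m1[of 2 "{c u3}" "c u1"] by simp
    then show ?thesis using that[of "?R \<union> {c u1, c u3}"] finY1 by simp
  next
    case False
    then show ?thesis using that[of "{}"] by simp
  qed
  obtain x2 where x2: "x2 \<notin> Z2" "partial a (b0(u1 := x1, u2 := x2)) {u2, u1}"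
    using partial_step[OF a x1(2), of u2 Z2] N Z2 \<kappa> by auto
  define Y2 where "Y2 = insert x2 (insert a (C u2))"
  let ?S = "{a, c u1, c u2, c u3, x1, x2}"
  \<comment> \<open>Only \<open>x3\<close> is to come: it avoids a colour of \<open>Y2\<close>
    outside \<open>?S\<close>, or, if there is none, avoiding \<open>c u1\<close> and
    \<open>c u2\<close> keeps it out of \<open>Y2\<close>.\<close>
  obtain Z3 where Z3: "finite Z3" "card Z3 \<le> 3"
    "{c u1, c u2} \<subseteq> Z3 \<and> Y2 \<subseteq> ?S \<or> Z3 \<inter> (Y2 - ?S) \<noteq> {}"
  proof (cases "Y2 \<subseteq> ?S")
    case True
    then show ?thesis
      using that[of "{c u1, c u2}"] card_insert_le_m1[of 3 "{c u2}" "c u1"] by simp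
  next
    case False
    then obtain z where "z \<in> Y2 - ?S" by blast
    then show ?thesis using that[of "{z}"] by simp
  qed
  have "card {u2, u1} = 2" using N by simp
  then obtain x3 where x3: "x3 \<notin> Z3"
    "partial a (b0(u1 := x1, u2 := x2, u3 := x3)) {u3, u2, u1}"
    using partial_step[OF a x2(2), of u3 Z3] N Z3 \<kappa> by auto
  let ?b = "b0(u1 := x1, u2 := x2, u3 := x3)"
  have p: "partial a ?b N" using x3 N by (simp add: insert_commute)
  have xs: "x1 \<noteq> x2" "x1 \<noteq> x3" "x2 \<noteq> x3" "x1 \<noteq> a" "x1 \<noteq> c u1" "x2 \<noteq> a" "x2 \<noteq> c u2"
    "x3 \<noteq> a" "x3 \<noteq> c u3"
    using partial_neq[OF p, of u1 u2] partial_neq[OF p, of u1 u3] partial_neq[OF p, of u2 u3]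
      partialD(1,2)[OF p, of u1] partialD(1,2)[OF p, of u2] partialD(1,2)[OF p, of u3] N
    by simp_all
  let ?S3 = "{a, c u1, c u2, c u3, x1, x2, x3}"
  have 1: "?S3 \<noteq> Y1"
  proof (cases "?R \<union> {c u1, c u3} \<subseteq> Z2")
    case True
    then have "x2 \<notin> Y1" using x2(1) xs by blast
    then show ?thesis by blast
  next
    case False
    then have "2 < card ?R" using Z2 by blast
    moreover have "card ?R \<le> card {x2, x3}" if "?S3 = Y1"
      using that by (intro card_mono) auto
    moreover have "card {x2, x3} \<le> 2" by (simp add: card_insert_if)
    ultimately show ?thesis by linarith
  qed
  have 2: "?S3 \<noteq> Y2"
  proof (cases "{c u1, c u2} \<subseteq> Z3 \<and> Y2 \<subseteq> ?S")
    case True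
    then have "x3 \<notin> Y2" using x3(1) xs by auto
    then show ?thesis by blast
  next
    case False
    then obtain z where "z \<in> Z3" "z \<in> Y2" "z \<notin> ?S" using Z3(3) by blast
    then have "z \<in> Y2" "z \<notin> ?S3" using x3(1) by auto
    then show ?thesis by metis
  qed
  have 3: "?S3 \<noteq> insert x3 (insert a (C u3))"
  proof (cases "?T \<union> {c u2, c u3} \<subseteq> Z1")
    case True
    then have "x1 \<notin> C u3" using x1(1) xs by blast
    then show ?thesis using xs by blast
  next
    case False
    then have "3 < card ?T" using Z1 by blast
    moreover have "card ?T \<le> card {x1, x2, x3}" if "?S3 = insert x3 (insert a (C u3))"
      using that by (intro card_mono) auto
    moreover have "card {x1, x2, x3} \<le> 3" by (simp add: card_insert_if)
    ultimately show ?thesis by linarith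
  qed
  have im: "insert a (c ` N \<union> ?b ` N) = ?S3" using N by auto
  have "complete a ?b"
    unfolding complete_def im using a p 1 2 3 N(2-) by (simp add: N(1) Y1_def Y2_def)
  then show ?thesis by blast
qed

end

section \<open>Extending a colouring to a vertex of degree at most three\<close>

text \<open>Reads the data of \<open>vertex_extension\<close> off the smaller graph and turns a
  \<open>complete\<close> choice into a colouring. \<open>D\<close> bounds degrees only at the
  neighbours of \<open>v\<close>, so it may be smaller than the maximum degree.\<close>

lemma extend_to_vertex:
  fixes V :: "'a set" and E :: "'a set set" and v :: 'a and f :: "'a + 'a set \<Rightarrow> nat"
  assumes simple: "simple_graph V E" and v: "v \<in> V"
    and good: "good_coloring (V - {v}) {e \<in> E. e \<inter> {v} = {}} \<kappa> f"
    and D: "\<And>u. u \<in> neighbors E v \<Longrightarrow> degree E u \<le> D"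
    and deg: "degree E v \<le> 3"
    and \<kappa>: "degree E v \<le> 1 \<Longrightarrow> 2 * D < \<kappa>" "degree E v = 2 \<Longrightarrow> 2 * D + 2 < \<kappa>"
      "degree E v = 3 \<Longrightarrow> 3 * D < \<kappa> \<and> 2 * D + 5 < \<kappa>"
  shows "\<exists>f'. good_coloring V E \<kappa> f'"
proof -
  define F where "F = {e \<in> E. e \<inter> {v} = {}}"
  define N where "N = neighbors E v"
  define M where "M = neighbors F"
  define c where "c u = f (Inl u)" for u
  define B where "B u = (\<lambda>w. f (Inr {u, w})) ` M u" for u
  define C where "C = color_set F f"
  have simpleF: "simple_graph (V - {v}) F"
    using subgraph_delete[OF simple, of "{v}"] by (simp add: subgraph_def F_def)
  have goodF: "good_coloring (V - {v}) F \<kappa> f" using good by (simp add: F_def)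
  then have pF: "proper_total_coloring (V - {v}) F \<kappa> f" by (simp add: good_coloring_def)
  note pF' = pF[unfolded proper_total_coloring_iff[OF simpleF]]
  have MF: "M u = (if u = v then {} else neighbors E u - {v})" for u
    unfolding M_def F_def neighbors_delete by simp
  have NE: "neighbors E u = (if u = v then N else if u \<in> N then insert v (M u) else M u)" for u
    using MF N_def neighbors_sym by (auto simp: N_def neighbors_sym[of v E u])
  have vN: "v \<notin> N" using not_self_neighbor[OF simple] by (simp add: N_def)
  have vM: "v \<notin> M u" for u using MF by simp
  have Msym: "w \<in> M u \<longleftrightarrow> u \<in> M w" for u w using neighbors_sym by (simp add: M_def)
  have finM: "finite (M u)" for u using finite_neighbors[OF simpleF] by (simp add: M_def)
  have finN: "finite N" using finite_neighbors[OF simple] by (simp add: N_def)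
  have degN: "degree E u = Suc (card (M u))" if "u \<in> N" for u
  proof -
    have "u \<noteq> v" using that vN by blast
    then show ?thesis using that finM vM by (simp add: degree_def NE)
  qed
  have Ceq: "C u = insert (c u) (c ` M u \<union> B u)" for u
    by (simp add: C_def color_set_eq M_def c_def B_def)
  have ext: "vertex_extension N M c B C D"
  proof
    show "finite N" by (fact finN)
    fix u assume u: "u \<in> N"
    show "finite (C u)" "finite (M u)" "finite (B u)" using finM by (simp_all add: Ceq B_def)
    show *: "card (M u) < D" using degN[OF u] D[of u] u by (simp add: N_def)
    show "card (B u) < D" unfolding B_def using * card_image_le[OF finM] le_less_trans by blast
    show "u \<notin> M u" using not_self_neighbor[OF simpleF] by (simp add: M_def)
    show "u \<in> M w" if "w \<in> M u" for w using that Msym by blast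
    show "C u \<noteq> C w \<or> C u \<subseteq> {c u, c w} \<union> B u" if w: "w \<in> M u" for w
    proof (cases "2 \<le> card (M u)")
      case True
      then show ?thesis using goodF w
        unfolding good_coloring_def C_def M_def degree_def by blast
    next
      \<comment> \<open>\<open>good_coloring\<close> may permit equal sets here, but then
        \<open>w\<close> is the only old neighbour of \<open>u\<close>, which determines
        \<open>C u\<close>.\<close>
      case False
      then have "card (M u) \<le> Suc 0" by simp
      then have "M u = {w}" using w finM[of u] by (auto simp: card_le_Suc0_iff_eq)
      then show ?thesis by (auto simp: Ceq)
    qed
  qed
  then interpret vertex_extension N M c B C D \<kappa> .
  have "card N \<le> 3" using deg by (simp add: degree_def N_def)
  then consider "card N = 0" | "card N = 1" | "card N = 2" | "card N = 3" by linarith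
  then have "\<exists>a b. complete a b"
  proof cases
    case 1
    then show ?thesis using complete_0 finN \<kappa>(1) by (simp add: degree_def N_def)
  next
    case 2
    then obtain u where u: "N = {u}" by (auto simp: card_1_singleton_iff)
    have "B u \<subseteq> C u - {c u}"
    proof -
      have "f (Inr {u, w}) \<noteq> c u" if "w \<in> M u" for w
        using pF' that unfolding M_def c_def by metis
      then show ?thesis by (auto simp: Ceq B_def)
    qed
    then show ?thesis using complete_1[OF u] \<kappa>(1) 2 by (simp add: degree_def N_def B_def)
  next
    case 3
    then obtain u1 u2 where "N = {u1, u2}" "u1 \<noteq> u2" by (auto simp: card_2_iff)
    then show ?thesis using complete_2 \<kappa>(2) 3 by (simp add: degree_def N_def)
  next
    case 4
    then obtain u1 u2 u3 where "N = {u1, u2, u3}" "u1 \<noteq> u2" "u1 \<noteq> u3" "u2 \<noteq> u3"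
      by (auto simp: card_3_iff)
    then show ?thesis using complete_3 \<kappa>(3) 4 by (simp add: degree_def N_def)
  qed
  then obtain a b where ab: "complete a b" by blast
  then have a: "center_color a" and b: "partial a b N" by (simp_all add: complete_def)
  \<comment> \<open>An edge at \<open>v\<close> is coloured according to its other end,
    \<open>the_elem (e - {v})\<close>.\<close>
  define f' where "f' x = (case x of Inl w \<Rightarrow> if w = v then a else f x
    | Inr e \<Rightarrow> if v \<in> e then b (the_elem (e - {v})) else f x)" for x
  have f'v: "f' (Inl v) = a" by (simp add: f'_def)
  have f'w: "f' (Inl w) = c w" if "w \<noteq> v" for w using that by (simp add: f'_def c_def)
  have f'b: "f' (Inr {v, u}) = b u" "f' (Inr {u, v}) = b u" if "u \<noteq> v" for u
  proof -
    have "{v, u} - {v} = {u}" "{u, v} - {v} = {u}" using that by auto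
    then show "f' (Inr {v, u}) = b u" "f' (Inr {u, v}) = b u" by (simp_all add: f'_def)
  qed
  have f'e: "f' (Inr {u, w}) = f (Inr {u, w})" if "u \<noteq> v" "w \<noteq> v" for u w
    using that by (simp add: f'_def)
  have Nv: "u \<noteq> v" if "u \<in> N" for u using that vN by blast
  have Mv: "w \<noteq> v" if "w \<in> M u" for u w using that vM by blast
  have im: "(\<lambda>w. f' (Inl w)) ` N = c ` N" "(\<lambda>w. f' (Inr {v, w})) ` N = b ` N"
    using Nv f'w f'b by (auto intro!: image_cong)
  have imM: "(\<lambda>w. f' (Inl w)) ` M u = c ` M u" "(\<lambda>w. f' (Inr {u, w})) ` M u = B u"
    if "u \<noteq> v" for u
    using Mv f'w f'e that unfolding B_def by (auto intro!: image_cong)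
  have csv: "color_set E f' v = insert a (c ` N \<union> b ` N)"
    by (simp add: color_set_eq NE f'v im)
  have csu: "color_set E f' u = cols a b N u" if "u \<noteq> v" for u
    using that by (auto simp: color_set_eq[of E] NE f'v f'w f'b imM cols_def Ceq)
  have adj: "w \<in> M u \<or> u = v \<and> w \<in> N \<or> w = v \<and> u \<in> N" if "w \<in> neighbors E u" for u w
    using that NE[of u] by (auto split: if_splits)
  have "proper_total_coloring V E \<kappa> f'"
    unfolding proper_total_coloring_iff[OF simple]
  proof (intro conjI ballI allI impI)
    fix u assume "u \<in> V"
    then show "f' (Inl u) \<in> {1..\<kappa>}"
      using pF' a by (cases "u = v") (simp_all add: f'v f'w c_def center_color_def)
  next
    fix u w assume "w \<in> neighbors E u"
    from adj[OF this]
    have "f' (Inr {u, w}) \<in> {1..\<kappa>} \<and> f' (Inl u) \<noteq> f' (Inl w) \<and> f' (Inl u) \<noteq> f' (Inr {u, w})"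
    proof (elim disjE conjE)
      assume w: "w \<in> M u"
      then have "u \<noteq> v" "w \<noteq> v" using Mv Msym by blast+
      then show ?thesis using pF' w by (simp add: f'w f'e c_def M_def)
    next
      assume "u = v" "w \<in> N"
      then show ?thesis using Nv[of w] partialD[OF b, of w] a
        by (auto simp: f'v f'w f'b center_color_def)
    next
      assume "w = v" "u \<in> N"
      then show ?thesis using Nv[of u] partialD[OF b, of u] a
        by (auto simp: f'v f'w f'b center_color_def)
    qed
    then show "f' (Inr {u, w}) \<in> {1..\<kappa>}" "f' (Inl u) \<noteq> f' (Inl w)"
      "f' (Inl u) \<noteq> f' (Inr {u, w})" by auto
  next
    fix u w1 w2 assume w: "w1 \<in> neighbors E u" "w2 \<in> neighbors E u" "w1 \<noteq> w2"
    show "f' (Inr {u, w1}) \<noteq> f' (Inr {u, w2})"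
    proof (cases "u = v")
      case True
      then have "w1 \<in> N" "w2 \<in> N" using w NE by auto
      then show ?thesis using partial_neq[OF b, of w1 w2] w(3) True Nv by (simp add: f'b)
    next
      case False
      have fresh: "f' (Inr {u, w}) \<noteq> b u" if "w \<in> M u" "u \<in> N" for w
      proof -
        have "f (Inr {u, w}) \<in> B u" using that by (simp add: B_def)
        then show ?thesis using partialD(4)[OF b that(2)] f'e[OF False Mv[OF that(1)]] by metis
      qed
      have "w1 \<in> M u \<or> w1 = v \<and> u \<in> N" "w2 \<in> M u \<or> w2 = v \<and> u \<in> N"
        using adj w False by blast+
      then show ?thesis
      proof (elim disjE conjE)
        assume M: "w1 \<in> M u" "w2 \<in> M u"
        then have "f (Inr {u, w1}) \<noteq> f (Inr {u, w2})" using pF' w(3) by (simp add: M_def)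
        then show ?thesis using M Mv False by (simp add: f'e)
      qed (use fresh w(3) f'b(2)[OF False] in metis)+
    qed
  qed
  moreover have "color_set E f' u \<noteq> color_set E f' w"
    if w: "w \<in> neighbors E u" and 2: "2 \<le> degree E u" for u w
    using adj[OF w]
  proof (elim disjE conjE)
    assume wM: "w \<in> M u"
    then have uM: "u \<in> M w" and neq: "u \<noteq> v" "w \<noteq> v" using Mv Msym by blast+
    have "cols a b N u \<noteq> cols a b N w"
    proof (cases "u \<in> N \<or> w \<in> N")
      case True
      then show ?thesis using b wM uM unfolding partial_def by metis
    next
      \<comment> \<open>Neither set changes and \<open>u\<close> keeps its degree, so the old
        colouring separates them.\<close>
      case False
      then have "2 \<le> degree F u" using 2 neq NE[of u] by (simp add: degree_def M_def)
      then have "C u \<noteq> C w" using goodF wM unfolding good_coloring_def C_def M_def by blast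
      then show ?thesis using False by (simp add: cols_def)
    qed
    then show ?thesis using csu neq by simp
  next
    assume "u = v" "w \<in> N"
    moreover then have "2 \<le> card N" using 2 by (simp add: degree_def N_def)
    ultimately show ?thesis using ab Nv[of w] csv csu[of w] by (simp add: complete_def cols_def)
  next
    assume u: "w = v" "u \<in> N"
    then have "M u \<noteq> {}" using 2 degN[of u] by auto
    then have "color_set E f' v \<noteq> color_set E f' u"
      using u ab Nv[of u] csv csu[of u] by (simp add: complete_def cols_def)
    then show ?thesis using u by simp
  qed
  ultimately show ?thesis unfolding good_coloring_def by blast
qed

section \<open>Reinserting the leaves at a vertex\<close>

text \<open>The leaves get the colour \<open>q\<close>, which \<open>u\<close> sees already, so the
  set of \<open>u\<close> becomes \<open>?Q \<union> A\<close> with \<open>A\<close> the set of new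
  edge colours, while that of \<open>p\<close> is unchanged. Outside \<open>?Q\<close> there are at
  least \<open>degree E u = card X + 1\<close> colours, one more than \<open>A\<close>
  needs.\<close>

lemma extend_to_leaves:
  fixes V :: "'a set" and E :: "'a set set" and f :: "'a + 'a set \<Rightarrow> nat"
  assumes simple: "simple_graph V E" and nu: "neighbors E u = insert p X" and p: "p \<notin> X"
    and X: "X \<noteq> {}" and leaves: "\<And>x. x \<in> X \<Longrightarrow> neighbors E x = {u}"
    and \<kappa>: "degree E u + 3 \<le> \<kappa>"
    and good: "good_coloring (V - X) {e \<in> E. e \<inter> X = {}} \<kappa> f"
  shows "\<exists>f'. good_coloring V E \<kappa> f'"
proof -
  define F where "F = {e \<in> E. e \<inter> X = {}}"
  have simpleF: "simple_graph (V - X) F"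
    using subgraph_delete[OF simple, of X] by (simp add: subgraph_def F_def)
  have goodF: "good_coloring (V - X) F \<kappa> f" using good by (simp add: F_def)
  then have pF: "proper_total_coloring (V - X) F \<kappa> f" by (simp add: good_coloring_def)
  note pF' = pF[unfolded proper_total_coloring_iff[OF simpleF]]
  have uX: "u \<notin> X" and up: "u \<noteq> p" using nu not_self_neighbor[OF simple, of u] by auto
  have finX: "finite X" using finite_neighbors[OF simple, of u] nu by simp
  have nF: "neighbors F w = (if w \<in> X then {} else neighbors E w - X)" for w
    unfolding F_def by (rule neighbors_delete)
  have nE: "neighbors E w = neighbors F w" if "w \<notin> X" "w \<noteq> u" for w
  proof -
    have "neighbors E w \<inter> X = {}"
      using leaves that(2) neighbors_sym by (metis disjoint_iff singletonD)
    then show ?thesis using that(1) nF[of w] by auto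
  qed
  have nFu: "neighbors F u = {p}" using nF[of u] uX nu p by auto
  then have pu: "p \<in> neighbors F u" "u \<in> neighbors F p" by (simp_all add: neighbors_sym[of u F])
  define q where "q = f (Inr {u, p})"
  let ?Q = "{f (Inl u), f (Inl p), q}"
  have q: "q \<in> {1..\<kappa>}" "f (Inl u) \<noteq> f (Inl p)" "f (Inl u) \<noteq> q"
    using pF' pu unfolding q_def by metis+
  have "f (Inl p) \<noteq> f (Inr {p, u})" using pF' pu by metis
  then have q': "f (Inl p) \<noteq> q" by (simp add: q_def insert_commute)
  have "p \<in> V" "u \<in> V" using edgeD(1,2)[OF simple, of u p] nu neighbors_iff[of p E u] by simp_all
  then have "?Q \<subseteq> {1..\<kappa>}" using pF' q(1) uX p by simp
  moreover define P where "P = {1..\<kappa>} - ?Q"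
  ultimately have "card P = \<kappa> - card ?Q" by (simp add: card_Diff_subset)
  also have "card ?Q = 3" using q q' by simp
  finally have cP: "card X < card P" using \<kappa> nu p finX by (simp add: degree_def)
  have finP: "finite P" by (simp add: P_def)
  \<comment> \<open>If \<open>p\<close> sees all of \<open>P\<close>, any \<open>A\<close> of the
    right size misses one of these colours; otherwise \<open>A\<close> receives a colour that
    \<open>p\<close> does not see.\<close>
  obtain A where A: "A \<subseteq> P" "card A = card X" "?Q \<union> A \<noteq> color_set F f p"
  proof (cases "P \<subseteq> color_set F f p")
    case True
    obtain A where A: "A \<subseteq> P" "card A = card X"
      using obtain_subset_with_card_n[of "card X" P] cP by auto
    then obtain y where "y \<in> P" "y \<notin> A" using cP by (metis less_irrefl subsetI subset_antisym)
    then have "y \<notin> ?Q \<union> A" "y \<in> color_set F f p" using True by (auto simp: P_def)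
    then show ?thesis using that A by blast
  next
    case False
    then obtain y where y: "y \<in> P" "y \<notin> color_set F f p" by blast
    have "card X - 1 \<le> card (P - {y})" using cP y finP by simp
    then obtain A where A: "A \<subseteq> P - {y}" "card A = card X - 1"
      using obtain_subset_with_card_n by metis
    then have "card (insert y A) = card X"
      using finite_subset[OF A(1)] finP X finX by (subst card_insert_disjoint) (auto simp: card_gt_0_iff)
    then show ?thesis using that[of "insert y A"] A(1) y by blast
  qed
  obtain b where b: "bij_betw b X A"
    using finite_same_card_bij[OF finX finite_subset[OF A(1) finP]] A(2) by auto
  have bP: "b x \<in> P" if "x \<in> X" for x using that b A(1) by (auto simp: bij_betw_def)
  define f' where "f' x = (case x of Inl w \<Rightarrow> if w \<in> X then q else f x
    | Inr e \<Rightarrow> if e \<inter> X \<noteq> {} then b (the_elem (e - {u})) else f x)" for x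
  have f'X: "f' (Inl x) = q" if "x \<in> X" for x using that by (simp add: f'_def)
  have f'w: "f' (Inl w) = f (Inl w)" if "w \<notin> X" for w using that by (simp add: f'_def)
  have f'b: "f' (Inr {x, u}) = b x" "f' (Inr {u, x}) = b x" if "x \<in> X" for x
  proof -
    have "{x, u} - {u} = {x}" "{u, x} - {u} = {x}" using that uX by auto
    then show "f' (Inr {x, u}) = b x" "f' (Inr {u, x}) = b x" using that by (simp_all add: f'_def)
  qed
  have f'e: "f' (Inr {w, t}) = f (Inr {w, t})" if "w \<notin> X" "t \<notin> X" for w t
    using that by (simp add: f'_def)
  have nFX: "t \<notin> X" if "t \<in> neighbors F w" for t w using that nF[of w] by (auto split: if_splits)
  have adj: "w \<in> X \<and> t = u \<or> w = u \<and> t \<in> X \<or> w \<notin> X \<and> t \<notin> X \<and> t \<in> neighbors F w"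
    if "t \<in> neighbors E w" for w t
    using that leaves[of w] leaves[of t] nF[of w] neighbors_sym[of t E w] by auto
  have csu: "color_set E f' u = ?Q \<union> A"
  proof -
    have "(\<lambda>x. f' (Inl x)) ` X = {q}" using X f'X by auto
    moreover have "(\<lambda>x. f' (Inr {u, x})) ` X = A" using f'b b by (simp add: bij_betw_def)
    ultimately show ?thesis
      using f'w[OF uX] f'w[OF p] f'e[OF uX p] by (auto simp: color_set_eq nu q_def)
  qed
  have csX: "color_set E f' x = {q, f (Inl u), b x}" if "x \<in> X" for x
    using that by (auto simp: color_set_eq leaves f'X f'w[OF uX] f'b)
  have csw: "color_set E f' w = color_set F f w" if "w \<notin> X" "w \<noteq> u" for w
    unfolding color_set_eq nE[OF that] using that f'w f'e nFX by (auto intro!: image_cong)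
  have "proper_total_coloring V E \<kappa> f'"
    unfolding proper_total_coloring_iff[OF simple]
  proof (intro conjI ballI allI impI)
    fix w assume "w \<in> V"
    then show "f' (Inl w) \<in> {1..\<kappa>}"
      using pF' q(1) by (cases "w \<in> X") (simp_all add: f'X f'w)
  next
    fix w t assume "t \<in> neighbors E w"
    from adj[OF this]
    have "f' (Inr {w, t}) \<in> {1..\<kappa>} \<and> f' (Inl w) \<noteq> f' (Inl t) \<and> f' (Inl w) \<noteq> f' (Inr {w, t})"
    proof (elim disjE conjE)
      assume "w \<in> X" "t = u"
      then show ?thesis using bP[of w] q uX by (auto simp: f'X f'w f'b P_def)
    next
      assume "w = u" "t \<in> X"
      then show ?thesis using bP[of t] q uX by (auto simp: f'X f'w f'b P_def)
    next
      assume "w \<notin> X" "t \<notin> X" "t \<in> neighbors F w"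
      then show ?thesis using pF' by (simp add: f'w f'e)
    qed
    then show "f' (Inr {w, t}) \<in> {1..\<kappa>}" "f' (Inl w) \<noteq> f' (Inl t)"
      "f' (Inl w) \<noteq> f' (Inr {w, t})" by auto
  next
    fix w t1 t2 assume t: "t1 \<in> neighbors E w" "t2 \<in> neighbors E w" "t1 \<noteq> t2"
    consider "w \<in> X" | "w = u" | "w \<notin> X" "w \<noteq> u" by blast
    then show "f' (Inr {w, t1}) \<noteq> f' (Inr {w, t2})"
    proof cases
      case 1
      then show ?thesis using t leaves[of w] by auto
    next
      case 2
      have "f' (Inr {u, p}) = q" using f'e[OF uX p] by (simp add: q_def)
      moreover have "b x \<noteq> q" if "x \<in> X" for x using bP[OF that] by (simp add: P_def)
      moreover have "b x \<noteq> b y" if "x \<in> X" "y \<in> X" "x \<noteq> y" for x y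
        using that b by (auto simp: bij_betw_def inj_on_def)
      ultimately show ?thesis using 2 t nu f'b by (metis insertE)
    next
      case 3
      then have "t1 \<in> neighbors F w" "t2 \<in> neighbors F w" using t nE by auto
      then show ?thesis using pF' t(3) f'e 3(1) nFX by metis
    qed
  qed
  moreover have "color_set E f' w \<noteq> color_set E f' t"
    if t: "t \<in> neighbors E w" and 2: "2 \<le> degree E w" for w t
    using adj[OF t]
  proof (elim disjE conjE)
    assume "w \<in> X" "t = u"
    then show ?thesis using 2 leaves[of w] by (simp add: degree_def)
  next
    assume w: "w = u" "t \<in> X"
    then have "f (Inl p) \<in> color_set E f' w" "f (Inl p) \<notin> color_set E f' t"
      using csu csX[of t] q q' bP[of t] by (auto simp: P_def)
    then show ?thesis by metis
  next
    assume w: "w \<notin> X" "t \<notin> X" "t \<in> neighbors F w"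
    consider "w = u" | "t = u" | "w \<noteq> u" "t \<noteq> u" by blast
    then show ?thesis
    proof cases
      case 1
      then have "t = p" using w nFu by simp
      then show ?thesis using 1 csu csw[OF p] up A(3) by simp
    next
      case 2
      then have "w = p" using w nFu neighbors_sym[of w F u] by simp
      then show ?thesis using 2 csu csw[OF p] up A(3) by simp
    next
      case 3
      have "2 \<le> degree F w" using 2 nE[OF w(1) 3(1)] by (simp add: degree_def)
      then show ?thesis using goodF w csw 3 unfolding good_coloring_def by simp
    qed
  qed
  ultimately show ?thesis unfolding good_coloring_def by blast
qed

section \<open>Induction on the number of vertices\<close>

text \<open>\<open>D\<close> is any upper bound instead of the maximum degree, so that the number of
  colours stays fixed when vertices are deleted.\<close>

lemma ex_good_coloring_forest:
  assumes "simple_graph V E" "degenerated 1 V E" "\<And>u. u \<in> V \<Longrightarrow> degree E u \<le> D"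
  shows "\<exists>f. good_coloring V E (D + 3) f"
  using assms
proof (induction "card V" arbitrary: V E rule: less_induct)
  case less
  note simple = less.prems(1)
  have finV: "finite V" using simple by (simp add: simple_graph_def)
  have delete: "\<exists>f. good_coloring (V - X) {e \<in> E. e \<inter> X = {}} (D + 3) f"
    if "X \<subseteq> V" "X \<noteq> {}" for X
  proof (rule less.hyps)
    note sub = subgraph_delete[OF simple, of X]
    show "card (V - X) < card V" using that finV by (intro psubset_card_mono) auto
    show "simple_graph (V - X) {e \<in> E. e \<inter> X = {}}" using sub by (simp add: subgraph_def)
    show "degenerated 1 (V - X) {e \<in> E. e \<inter> X = {}}"
      using degenerated_subgraph[OF less.prems(2) sub] .
    show "degree {e \<in> E. e \<inter> X = {}} u \<le> D" if "u \<in> V - X" for u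
      using degree_subset_le[OF simple, of "{e \<in> E. e \<inter> X = {}}" u] less.prems(3)[of u] that by auto
  qed
  define W where "W = {u \<in> V. 2 \<le> degree E u}"
  show ?case
  proof (cases "W = {}")
    case True
    then have small: "degree E u \<le> 1" if "u \<in> V" for u using that by (force simp: W_def)
    show ?thesis
    proof (cases "V = {}")
      case True
      then have "neighbors E u = {}" for u using edgeD[OF simple] by (auto simp: neighbors_iff)
      then have "good_coloring V E (D + 3) (\<lambda>_. 0)"
        unfolding good_coloring_def proper_total_coloring_iff[OF simple] using True by simp
      then show ?thesis by blast
    next
      case False
      then obtain v where v: "v \<in> V" by blast
      then obtain f where f: "good_coloring (V - {v}) {e \<in> E. e \<inter> {v} = {}} (D + 3) f"
        using delete[of "{v}"] by auto
      have "degree E u \<le> 1" if "u \<in> neighbors E v" for u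
        using that edgeD(2)[OF simple] small by (simp add: neighbors_iff)
      then show ?thesis
        \<comment> \<open>With the local degree bound 1 the requirement is \<open>2 < D + 3\<close>,
          whereas \<open>2 * D < D + 3\<close> may fail.\<close>
        using small[OF v] by (intro extend_to_vertex[OF simple v f, of 1]) auto
    qed
  next
    case False
    \<comment> \<open>Degeneracy of the graph induced on the vertices of degree at least 2 yields a
      vertex whose neighbours are leaves with at most one exception.\<close>
    have "subgraph W {e \<in> E. e \<subseteq> W} V E"
      using simple by (auto simp: subgraph_def simple_graph_def W_def finite_subset)
    then obtain u where u: "u \<in> W" "degree {e \<in> E. e \<subseteq> W} u \<le> 1"
      using degenerated_vertex[OF less.prems(2)] False by metis
    have "neighbors {e \<in> E. e \<subseteq> W} u = neighbors E u \<inter> W"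
      using u(1) by (auto simp: neighbors_def)
    then have cW: "card (neighbors E u \<inter> W) \<le> 1" using u(2) by (simp add: degree_def)
    note finu = finite_neighbors[OF simple, of u]
    have two: "2 \<le> card (neighbors E u)" using u(1) by (simp add: W_def degree_def)
    \<comment> \<open>\<open>p\<close> is the exceptional neighbour if there is one, and any
      neighbour otherwise.\<close>
    obtain p where p: "p \<in> neighbors E u" "neighbors E u \<inter> W \<subseteq> {p}"
    proof (cases "neighbors E u \<inter> W = {}")
      case True
      moreover obtain p where "p \<in> neighbors E u" using two by fastforce
      ultimately show ?thesis using that by auto
    next
      case False
      then obtain p where "p \<in> neighbors E u \<inter> W" by blast
      moreover then have "neighbors E u \<inter> W \<subseteq> {p}"
        using cW finu card_le_Suc0_iff_eq[of "neighbors E u \<inter> W"] by auto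
      ultimately show ?thesis using that by blast
    qed
    define X where "X = neighbors E u - {p}"
    have nu: "neighbors E u = insert p X" and pX: "p \<notin> X" using p by (auto simp: X_def)
    have X: "X \<noteq> {}" using two nu by auto
    have XV: "X \<subseteq> V" using edgeD(2)[OF simple] by (auto simp: X_def neighbors_iff)
    have leaves: "neighbors E x = {u}" if x: "x \<in> X" for x
    proof -
      have "x \<notin> W" using p x by (auto simp: X_def)
      then have "card (neighbors E x) \<le> Suc 0" using x XV by (auto simp: W_def degree_def)
      moreover have "u \<in> neighbors E x" using x neighbors_sym[of u E x] by (simp add: X_def)
      ultimately show ?thesis
        using finite_neighbors[OF simple, of x] by (auto simp: card_le_Suc0_iff_eq)
    qed
    obtain f where f: "good_coloring (V - X) {e \<in> E. e \<inter> X = {}} (D + 3) f"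
      using delete XV X by blast
    have "degree E u + 3 \<le> D + 3" using less.prems(3)[of u] u(1) by (simp add: W_def)
    then show ?thesis using extend_to_leaves[OF simple nu pX X leaves _ f] by blast
  qed
qed

text \<open>A vertex of degree at most \<open>k\<close> is deleted and put back by
  \<open>extend_to_vertex\<close>.\<close>

lemma ex_good_coloring:
  assumes "k = 2 \<or> k = 3"
    and "simple_graph V E" "degenerated k V E" "\<And>u. u \<in> V \<Longrightarrow> degree E u \<le> D"
  shows "\<exists>f. good_coloring V E (k * D + 3) f"
  using assms(2-)
proof (induction "card V" arbitrary: V E rule: less_induct)
  case less
  note simple = less.prems(1)
  have finV: "finite V" using simple by (simp add: simple_graph_def)
  show ?case
  proof (cases "V = {}")
    case True
    then have "neighbors E u = {}" for u using edgeD[OF simple] by (auto simp: neighbors_iff)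
    then have "good_coloring V E (k * D + 3) (\<lambda>_. 0)"
      unfolding good_coloring_def proper_total_coloring_iff[OF simple] using True by simp
    then show ?thesis by blast
  next
    case False
    have "subgraph V E V E" using simple by (simp add: subgraph_def)
    then obtain v where v: "v \<in> V" "degree E v \<le> k"
      using degenerated_vertex[OF less.prems(2)] False by metis
    let ?F = "{e \<in> E. e \<inter> {v} = {}}"
    have "\<exists>f. good_coloring (V - {v}) ?F (k * D + 3) f"
    proof (rule less.hyps)
      note sub = subgraph_delete[OF simple, of "{v}"]
      show "card (V - {v}) < card V" using v finV by (intro psubset_card_mono) auto
      show "simple_graph (V - {v}) ?F" using sub by (simp add: subgraph_def)
      show "degenerated k (V - {v}) ?F" using degenerated_subgraph[OF less.prems(2) sub] .
      show "degree ?F u \<le> D" if "u \<in> V - {v}" for u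
        using degree_subset_le[OF simple, of ?F u] less.prems(3)[of u] that by auto
    qed
    then obtain f where f: "good_coloring (V - {v}) ?F (k * D + 3) f" by blast
    have nb: "degree E u \<le> D" if "u \<in> neighbors E v" for u
      using that edgeD(2)[OF simple] less.prems(3) by (simp add: neighbors_iff)
    \<comment> \<open>If \<open>v\<close> has degree 3, then \<open>2 * D + 5 < 3 * D + 3\<close>
      needs \<open>D \<ge> 3\<close>, which the degree of \<open>v\<close> itself provides.\<close>
    have "degree E v \<le> D" using less.prems(3) v(1) by blast
    then show ?thesis
      using v(2) assms(1) nb by (intro extend_to_vertex[OF simple v(1) f, of D]) auto
  qed
qed

section \<open>The upper bound for \<open>chi_1_vsdt\<close>\<close>

theorem theorem1p11:
  fixes V :: "'a set" and E :: "'a set set" and k :: nat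
  assumes "k \<in> {1, 2, 3}"
    and "simple_graph V E"
    and "degenerated k V E"
    and "no_isolated_edge V E"
  shows "chi_1_vsdt V E \<le> enat (k * max_degree V E + 3)"
proof -
  have "finite V" using assms(2) by (simp add: simple_graph_def)
  then have D: "degree E u \<le> max_degree V E" if "u \<in> V" for u
    using that by (simp add: max_degree_def)
  have "\<exists>f. good_coloring V E (k * max_degree V E + 3) f"
  proof (cases "k = 1")
    case True
    then show ?thesis using ex_good_coloring_forest[of V E] assms(2,3) D by simp
  next
    case False
    then show ?thesis using ex_good_coloring[of k V E] assms(1-3) D by auto
  qed
  then obtain f where "good_coloring V E (k * max_degree V E + 3) f" by blast
  then have "D1_VSDTC V E (k * max_degree V E + 3) f"
    using good_coloring_imp_D1_VSDTC assms(2,4) by blast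
  then show ?thesis unfolding chi_1_vsdt_def by (intro Inf_lower) blast
qed

end
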